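(* Let $G$ be a finite simple undirected graph on $n$ vertices with adjacency eigenvalues $\lambda_1,\dots,\lambda_n$. If $|\lambda_i|\ge 2$ for all non-zero eigenvalues $\lambda_i$ of $G$, then $E(G^*\otimes K_2)=E(G^{**})$. Moreover, the graphs $G^*\otimes K_2$ and $G^{**}$ are non-cospectral and have an equal number of vertices.
   Context: The energy $E(H)$ of a graph $H$ is the sum of the absolute values of its adjacency eigenvalues; graphs are non-cospectral if their adjacency spectra (as multisets) differ. For a graph $G$ with vertex set $\{v_1,\dots,v_n\}$, the extended double cover $G^*$ is the bipartite graph with parts $X=\{x_1,\dots,x_n\}$, $Y=\{y_1,\dots,y_n\}$, where $x_i$ is adjacent to $y_j$ iff $i=j$ or $v_i$ is adjacent to $v_j$ in $G$. $G^{**}=(G^* )^*$. The Kronecker product $G_1\otimes G_2$ has vertex set $V(G_1)\times V(G_2)$, with $(u_1,v_1)$ adjacent to $(u_2,v_2)$ iff $u_1u_2$ is an edge of $G_1$ and $v_1v_2$ is an edge of $G_2$. *)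

theory Defs
  imports
    "Jordan_Normal_Form.Char_Poly"
    "Graph_Theory.Graph_Theory"
    "HOL-Computational_Algebra.Fundamental_Theorem_Algebra"
begin

text \<open>
  Finite simple undirected graphs are those with \<^prop>\<open>pair_graph G\<close>: the vertex set is finite,
  and the arc set is a symmetric irreflexive relation on it, so that an edge \<open>uv\<close> is
  represented by the two arcs \<open>(u, v)\<close> and \<open>(v, u)\<close>.
\<close>

definition adjacency_matrix :: "'a pair_pre_digraph \<Rightarrow> 'a list \<Rightarrow> complex mat" where
  "adjacency_matrix G vs =
     mat (length vs) (length vs) (\<lambda>(i, j). if (vs ! i, vs ! j) \<in> parcs G then 1 else 0)"

text \<open>
  The spectrum is the multiset of eigenvalues with algebraic multiplicity. It is taken over the
  complex numbers, where the characteristic polynomial splits, so that no eigenvalue can be lost.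
  The choice of the enumeration is immaterial by \<open>adj_spectrum_eq\<close> below.
\<close>

definition adj_spectrum :: "'a pair_pre_digraph \<Rightarrow> complex multiset" where
  "adj_spectrum G =
     proots (char_poly (adjacency_matrix G (SOME vs. distinct vs \<and> set vs = pverts G)))"

definition graph_energy :: "'a pair_pre_digraph \<Rightarrow> real" where
  "graph_energy G = (\<Sum>x\<in>#adj_spectrum G. cmod x)"

definition cospectral :: "'a pair_pre_digraph \<Rightarrow> 'b pair_pre_digraph \<Rightarrow> bool" where
  "cospectral G H \<longleftrightarrow> adj_spectrum G = adj_spectrum H"

text \<open>The vertices \<open>x\<^sub>i\<close> and \<open>y\<^sub>i\<close> are \<open>Inl v\<^sub>i\<close> and \<open>Inr v\<^sub>i\<close>.\<close>

definition extended_double_cover :: "'a pair_pre_digraph \<Rightarrow> ('a + 'a) pair_pre_digraph" where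
  "extended_double_cover G =
     \<lparr> pverts = pverts G <+> pverts G,
       parcs = {(Inl u, Inr v) |u v. u \<in> pverts G \<and> v \<in> pverts G \<and> (u = v \<or> (u, v) \<in> parcs G)}
             \<union> {(Inr v, Inl u) |u v. u \<in> pverts G \<and> v \<in> pverts G \<and> (u = v \<or> (u, v) \<in> parcs G)} \<rparr>"

definition kronecker_product ::
    "'a pair_pre_digraph \<Rightarrow> 'b pair_pre_digraph \<Rightarrow> ('a \<times> 'b) pair_pre_digraph" where
  "kronecker_product G H =
     \<lparr> pverts = pverts G \<times> pverts H,
       parcs = {((u1, v1), (u2, v2)) |u1 v1 u2 v2. (u1, u2) \<in> parcs G \<and> (v1, v2) \<in> parcs H} \<rparr>"

definition K2 :: "bool pair_pre_digraph" where
  "K2 = \<lparr> pverts = UNIV, parcs = {(a, b). a \<noteq> b} \<rparr>"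

lemma complete_digraph_K2: "complete_digraph 2 (with_proj K2)"
  by (simp add: complete_digraph_pair_def K2_def)

lemma pair_graph_extended_double_cover:
  assumes "pair_graph G"
  shows "pair_graph (extended_double_cover G)"
proof -
  interpret pair_graph G by fact
  let ?H = "extended_double_cover G"
  have sub: "parcs ?H \<subseteq> pverts ?H \<times> pverts ?H"
    by (auto simp: extended_double_cover_def)
  have fin: "finite (pverts ?H)"
    by (simp add: extended_double_cover_def pair_finite_verts)
  have "finite (parcs ?H)"
    using sub fin by (meson finite_SigmaI finite_subset)
  moreover have "symmetric (with_proj ?H)"
    unfolding symmetric_def by (rule symI) (auto simp: extended_double_cover_def)
  moreover have "fst e \<noteq> snd e" if "e \<in> parcs ?H" for e
    using that by (auto simp: extended_double_cover_def)
  ultimately show ?thesis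
    using sub fin by unfold_locales auto
qed

lemma pair_graph_kronecker_product:
  assumes "pair_graph G" "pair_graph H"
  shows "pair_graph (kronecker_product G H)"
proof -
  interpret G: pair_graph G by fact
  interpret H: pair_graph H by fact
  let ?P = "kronecker_product G H"
  have sub: "parcs ?P \<subseteq> pverts ?P \<times> pverts ?P"
    by (auto simp: kronecker_product_def dest: G.in_arcsD1 G.in_arcsD2 H.in_arcsD1 H.in_arcsD2)
  have fin: "finite (pverts ?P)"
    by (simp add: kronecker_product_def G.pair_finite_verts H.pair_finite_verts)
  have "finite (parcs ?P)"
    using sub fin by (meson finite_SigmaI finite_subset)
  moreover have "symmetric (with_proj ?P)"
    using G.pair_sym_arcs H.pair_sym_arcs unfolding symmetric_def
    by (auto simp: kronecker_product_def sym_def)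
  moreover have "fst e \<noteq> snd e" if "e \<in> parcs ?P" for e
    using that by (auto simp: kronecker_product_def dest: G.pair_no_loops)
  ultimately show ?thesis
    using sub fin by unfold_locales auto
qed

lemma char_poly_adjacency_matrix_cong:
  assumes vs: "distinct vs" and ws: "distinct ws" and eq: "set vs = set ws"
  shows "char_poly (adjacency_matrix G vs) = char_poly (adjacency_matrix G ws)"
proof -
  define n where "n = length ws"
  have "mset vs = mset ws"
    using assms by (simp add: set_eq_iff_mset_eq_distinct)
  then obtain f where f: "f permutes {..<n}" "permute_list f ws = vs"
    unfolding n_def using mset_eq_permutation by blast
  have len: "length vs = n"
    using f(2) by (auto simp: n_def)
  have f': "f permutes {0..<n}"
    using f(1) by (simp add: atLeast0LessThan)
  have nth: "vs ! i = ws ! f i" if "i < n" for i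
    using f that unfolding n_def by (metis permute_list_nth)
  have fl: "f i < n" if "i < n" for i
    using f' that permutes_in_image by fastforce
  have inj: "f i = f j \<longleftrightarrow> i = j" for i j
    using f' by (metis permutes_inj injD)
  define M where "M = char_poly_matrix (adjacency_matrix G ws)"
  define N where "N = mat n n (\<lambda>(i, j). M $$ (f i, j))"
  have M: "M \<in> carrier_mat n n"
    by (simp add: M_def adjacency_matrix_def n_def)
  have N: "N \<in> carrier_mat n n"
    by (simp add: N_def)
  have "char_poly_matrix (adjacency_matrix G vs) = mat n n (\<lambda>(i, j). M $$ (f i, f j))"
    by (rule eq_matI)
      (auto simp: char_poly_matrix_def adjacency_matrix_def M_def len n_def[symmetric]
        nth fl inj)
  also have "\<dots> = transpose_mat (mat n n (\<lambda>(i, j). transpose_mat N $$ (f i, j)))"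
    by (rule eq_matI) (auto simp: N_def fl)
  also have "det \<dots> = det (mat n n (\<lambda>(i, j). transpose_mat N $$ (f i, j)))"
    by (rule det_transpose[of _ n]) simp
  also have "\<dots> = signof f * det (transpose_mat N)"
    using N by (intro det_permute_rows f') simp
  also have "det (transpose_mat N) = det N"
    by (rule det_transpose[OF N])
  also have "det N = signof f * det M"
    unfolding N_def by (rule det_permute_rows[OF M f'])
  finally show ?thesis
    by (simp add: char_poly_def M_def sign_def)
qed

lemma adj_spectrum_eq:
  assumes "distinct vs" "set vs = pverts G"
  shows "adj_spectrum G = proots (char_poly (adjacency_matrix G vs))"
proof -
  have "distinct (SOME vs. distinct vs \<and> set vs = pverts G) \<and>
        set (SOME vs. distinct vs \<and> set vs = pverts G) = pverts G"
    by (rule someI) (use assms in blast)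
  then show ?thesis
    unfolding adj_spectrum_def using assms
    by (intro arg_cong[of _ _ proots] char_poly_adjacency_matrix_cong) auto
qed

lemma size_adj_spectrum:
  assumes "finite (pverts G)"
  shows "size (adj_spectrum G) = card (pverts G)"
proof -
  obtain vs where vs: "distinct vs" "set vs = pverts G"
    using finite_distinct_list[OF assms] by blast
  have "adjacency_matrix G vs \<in> carrier_mat (length vs) (length vs)"
    by (simp add: adjacency_matrix_def)
  then have "degree (char_poly (adjacency_matrix G vs)) = length vs"
    using degree_monic_char_poly by blast
  then show ?thesis
    using vs by (simp add: adj_spectrum_eq size_proots_complex flip: distinct_card)
qed

end

theory Submission
  imports Defs "Jordan_Normal_Form.Schur_Decomposition"
begin

text \<open>
  The argument computes both spectra from the spectrum \<open>S\<close> of \<open>G\<close>. Let \<open>A\<close> be the adjacency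
  matrix of \<open>G\<close>. Listing the two parts one after the other, the adjacency matrix of the
  extended double cover has zero diagonal blocks and both off-diagonal blocks equal to \<open>A + I\<close>;
  that of \<open>H \<otimes> K\<^sub>2\<close> has the same shape, with the adjacency matrix of \<open>H\<close> as off-diagonal block.
  Such a matrix with off-diagonal block \<open>B\<close> has the eigenvalues of \<open>B\<close> together with those of
  \<open>- B\<close> (\<open>mat_spectrum_off_diagonal\<close>). Hence, with multiplicities and \<open>x\<close> running over \<open>S\<close>,
  the graph \<open>G\<^sup>* \<otimes> K\<^sub>2\<close> has the eigenvalues \<open>\<plusminus>(x + 1)\<close>, each twice, and \<open>G\<^sup>*\<^sup>*\<close> has the
  eigenvalues \<open>\<plusminus>(x + 2)\<close> and \<open>\<plusminus>x\<close>.

  So each \<open>x\<close> contributes \<open>4\<bar>x + 1\<bar>\<close> to one energy and \<open>2\<bar>x + 2\<bar> + 2\<bar>x\<bar>\<close> to the other. Since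
  \<open>A\<close> is symmetric, \<open>x\<close> is real, and the two contributions agree exactly when \<open>x + 2\<close> and \<open>x\<close> do
  not have opposite signs, in particular when \<open>x = 0\<close> or \<open>\<bar>x\<bar> \<ge> 2\<close>. The sums of the squares of
  the eigenvalues tell the two spectra apart: \<open>x\<close> contributes \<open>4(x + 1)\<^sup>2\<close> to one and
  \<open>2(x + 2)\<^sup>2 + 2x\<^sup>2 = 4(x + 1)\<^sup>2 + 4\<close> to the other, so they differ by four times the number of
  vertices of \<open>G\<close>.
\<close>

section \<open>Spectra of matrices\<close>

abbreviation mat_spectrum :: "complex mat \<Rightarrow> complex multiset" where
  "mat_spectrum A \<equiv> proots (char_poly A)"

lemma proots_prod_linear_factors:
  "proots (\<Prod>a\<leftarrow>as. [:- a, 1:]) = mset (as :: 'a :: idom list)"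
proof (induction as)
  case (Cons a as)
  have "(\<Prod>a\<leftarrow>as. [:- a, 1:]) \<noteq> 0"
    by (auto simp: prod_list_zero_iff)
  with Cons show ?case
    by (simp add: proots_mult del: mult_pCons_left)
qed simp

lemma char_poly_four_block_lower_left_zero:
  fixes A :: "'a :: idom mat"
  assumes A: "A \<in> carrier_mat n n" and B: "B \<in> carrier_mat n m" and D: "D \<in> carrier_mat m m"
  shows "char_poly (four_block_mat A B (0\<^sub>m m n) D) = char_poly A * char_poly D"
proof -
  have "char_poly_matrix (four_block_mat A B (0\<^sub>m m n) D) =
      four_block_mat (char_poly_matrix A) (map_mat (\<lambda>a. [:- a:]) B) (0\<^sub>m m n) (char_poly_matrix D)"
    using assms by (intro eq_matI) (auto simp: char_poly_matrix_def)
  also have "det \<dots> = det (char_poly_matrix A) * det (char_poly_matrix D)"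
    using assms by (intro det_four_block_mat_lower_left_zero[of _ n _ m]) auto
  finally show ?thesis
    by (simp add: char_poly_def)
qed

text \<open>
  Adding the second block column to the first and subtracting the first block row from the second
  is a similarity transformation. The resulting matrix is block triangular, with diagonal blocks
  \<open>B\<close> and \<open>- B\<close>.
\<close>

lemma char_poly_four_block_off_diagonal:
  fixes B :: "'a :: idom mat"
  assumes B: "B \<in> carrier_mat n n"
  shows "char_poly (four_block_mat (0\<^sub>m n n) B B (0\<^sub>m n n)) = char_poly B * char_poly (- B)"
proof -
  let ?M = "four_block_mat (0\<^sub>m n n) B B (0\<^sub>m n n)"
  let ?T = "four_block_mat B B (0\<^sub>m n n) (- B)"
  let ?P = "four_block_mat (1\<^sub>m n) (0\<^sub>m n n) (1\<^sub>m n) (1\<^sub>m n) :: 'a mat"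
  let ?Q = "four_block_mat (1\<^sub>m n) (0\<^sub>m n n) (- 1\<^sub>m n) (1\<^sub>m n) :: 'a mat"
  have uminus: "- B \<in> carrier_mat n n" "- 1\<^sub>m n \<in> carrier_mat n n"
    using B by auto
  have inv: "1\<^sub>m n + - 1\<^sub>m n = (0\<^sub>m n n :: 'a mat)" "- 1\<^sub>m n + 1\<^sub>m n = (0\<^sub>m n n :: 'a mat)"
    "B + - B = 0\<^sub>m n n" "B * - 1\<^sub>m n = - B" "- 0\<^sub>m n n = (0\<^sub>m n n :: 'a mat)"
    using B by (auto intro!: eq_matI)
  have "?P * ?T = four_block_mat B B B (0\<^sub>m n n)"
    using B uminus inv by (subst mult_four_block_mat[of _ n n _ n _ n _ _ n _ n]) auto
  then have "?P * ?T * ?Q = ?M"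
    using B uminus inv by (simp add: mult_four_block_mat[of _ n n _ n _ n _ _ n _ n])
  moreover have "?P * ?Q = 1\<^sub>m (n + n)" "?Q * ?P = 1\<^sub>m (n + n)"
    using uminus by (simp_all add: mult_four_block_mat[of _ n n _ n _ n _ _ n _ n] inv)
  ultimately have "similar_mat ?M ?T"
    using B by (intro similar_matI[of _ _ ?P ?Q "n + n"]) auto
  then have "char_poly ?M = char_poly ?T"
    by (rule char_poly_similar)
  then show ?thesis
    using char_poly_four_block_lower_left_zero[OF B B uminus(1)] by simp
qed

text \<open>
  Every complex square matrix is similar to a triangular one, and the same similarity carries an affine
  expression in the matrix to that expression in the triangular matrix, whose eigenvalues are on
  the diagonal.
\<close>

lemma mat_spectrum_affine:
  assumes A: "A \<in> carrier_mat n n"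
  shows "mat_spectrum (c \<cdot>\<^sub>m A + d \<cdot>\<^sub>m 1\<^sub>m n) = image_mset (\<lambda>x. c * x + d) (mat_spectrum A)"
proof -
  obtain es where es: "char_poly A = (\<Prod>a\<leftarrow>es. [:- a, 1:])"
    using char_poly_factorized[OF A] by blast
  obtain T where T: "T \<in> carrier_mat n n" "upper_triangular T" "similar_mat A T"
    using schur_decomposition_exists[OF A es] by blast
  then obtain P Q where PQ: "similar_mat_wit A T P Q"
    unfolding similar_mat_def by blast
  note PQ = similar_mat_witD2[OF A PQ]
  let ?A = "c \<cdot>\<^sub>m A + d \<cdot>\<^sub>m 1\<^sub>m n" and ?T = "c \<cdot>\<^sub>m T + d \<cdot>\<^sub>m 1\<^sub>m n"
  have T': "?T \<in> carrier_mat n n"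
    using T by simp
  have "P * ?T * Q = (c \<cdot>\<^sub>m (P * T) + d \<cdot>\<^sub>m P) * Q"
    using PQ T by (simp add: mult_add_distrib_mat[of _ n n _ n] mult_smult_distrib[of _ n n _ n])
  also have "\<dots> = ?A"
    using PQ T by (simp add: add_mult_distrib_mat[of _ n n _ _ n] mult_smult_assoc_mat[of _ n n _ n])
  finally have sim: "similar_mat ?A ?T"
    using PQ A T by (intro similar_matI[of _ _ P Q n]) auto
  have "upper_triangular ?T"
    using T(1,2) by (auto simp: upper_triangular_def)
  then have "char_poly ?A = (\<Prod>a\<leftarrow>diag_mat ?T. [:- a, 1:])"
    unfolding char_poly_similar[OF sim] by (rule char_poly_upper_triangular[OF T'])
  moreover have "diag_mat ?T = map (\<lambda>x. c * x + d) (diag_mat T)"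
    using T(1) by (auto simp: diag_mat_def)
  moreover have "char_poly A = (\<Prod>a\<leftarrow>diag_mat T. [:- a, 1:])"
    using char_poly_upper_triangular[OF T(1,2)] char_poly_similar[OF T(3)] by simp
  ultimately show ?thesis
    by (simp only: proots_prod_linear_factors mset_map)
qed

lemma mat_spectrum_off_diagonal:
  assumes B: "B \<in> carrier_mat n n"
  shows "mat_spectrum (four_block_mat (0\<^sub>m n n) B B (0\<^sub>m n n)) =
    mat_spectrum B + image_mset uminus (mat_spectrum B)"
proof -
  have "- B = (- 1) \<cdot>\<^sub>m B + 0 \<cdot>\<^sub>m 1\<^sub>m n"
    using B by (intro eq_matI) auto
  then have "mat_spectrum (- B) = image_mset uminus (mat_spectrum B)"
    using mat_spectrum_affine[OF B, of "- 1" 0] by simp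
  moreover have "char_poly B \<noteq> 0" "char_poly (- B) \<noteq> 0"
    using degree_monic_char_poly[OF B] degree_monic_char_poly[of "- B" n] B by auto
  ultimately show ?thesis
    by (simp add: char_poly_four_block_off_diagonal[OF B] proots_mult)
qed

text \<open>
  For an eigenvector \<open>v\<close> with eigenvalue \<open>k\<close>, evaluating the Hermitian form of \<open>A\<close> at \<open>v\<close> by letting
  \<open>A\<close> act on the left or on the right factor gives \<open>k\<close> and its conjugate, times the same non-zero
  number.
\<close>

lemma real_symmetric_eigenvalue_real:
  fixes A :: "complex mat"
  assumes A: "A \<in> carrier_mat n n" and symm: "transpose_mat A = A"
    and real: "\<And>i j. i < n \<Longrightarrow> j < n \<Longrightarrow> A $$ (i, j) \<in> \<real>"
    and k: "k \<in># mat_spectrum A"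
  shows "k \<in> \<real>"
proof -
  have "char_poly A \<noteq> 0"
    using degree_monic_char_poly[OF A] by auto
  with k have "eigenvalue A k"
    using eigenvalue_root_char_poly[OF A] by simp
  then obtain v where v: "v \<in> carrier_vec n" "v \<noteq> 0\<^sub>v n" and Av: "A *\<^sub>v v = k \<cdot>\<^sub>v v"
    using A unfolding eigenvalue_def eigenvector_def by auto
  have conj: "conjugate (A *\<^sub>v v) = A *\<^sub>v conjugate v"
  proof (rule eq_vecI)
    fix i assume "i < dim_vec (A *\<^sub>v conjugate v)"
    then have i: "i < n" using A by simp
    have "conjugate (A *\<^sub>v v) $ i = (\<Sum>j = 0..<n. cnj (A $$ (i, j)) * cnj (v $ j))"
      using A v i by (simp add: scalar_prod_def)
    also have "\<dots> = (\<Sum>j = 0..<n. A $$ (i, j) * cnj (v $ j))"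
      using real i by (intro sum.cong) (auto simp: Reals_cnj_iff)
    finally show "conjugate (A *\<^sub>v v) $ i = (A *\<^sub>v conjugate v) $ i"
      using A v i by (simp add: scalar_prod_def)
  qed (use A in simp)
  have "k * (v \<bullet>c v) = (A *\<^sub>v v) \<bullet>c v"
    using v by (simp add: Av)
  also have "\<dots> = v \<bullet> (A *\<^sub>v conjugate v)"
    using transpose_vec_mult_scalar[OF A carrier_vec_conjugate[OF v(1)] v(1)] v A symm
    by (metis (no_types, lifting) carrier_vec_conjugate comm_scalar_prod mult_mat_vec_carrier)
  also have "\<dots> = cnj k * (v \<bullet>c v)"
    using v by (simp add: Av conjugate_smult_vec flip: conj)
  finally show ?thesis
    using v by (simp add: Reals_cnj_iff)
qed

section \<open>Spectra of the graph constructions\<close>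

lemma adjacency_matrix_carrier [simp]:
  "adjacency_matrix G vs \<in> carrier_mat (length vs) (length vs)"
  by (simp add: adjacency_matrix_def)

lemma adj_spectrum_real:
  assumes "pair_graph G" and x: "x \<in># adj_spectrum G"
  shows "x \<in> \<real>"
proof -
  interpret pair_graph G by fact
  obtain vs where vs: "distinct vs" "set vs = pverts G"
    using finite_distinct_list[OF pair_finite_verts] by blast
  have "(u, v) \<in> parcs G \<longleftrightarrow> (v, u) \<in> parcs G" for u v
    using arcs_symmetric by blast
  then have "transpose_mat (adjacency_matrix G vs) = adjacency_matrix G vs"
    by (intro eq_matI) (simp_all add: adjacency_matrix_def)
  moreover have "adjacency_matrix G vs $$ (i, j) \<in> \<real>" if "i < length vs" "j < length vs" for i j
    using that by (simp add: adjacency_matrix_def)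
  ultimately show ?thesis
    using real_symmetric_eigenvalue_real[OF adjacency_matrix_carrier] x
    unfolding adj_spectrum_eq[OF vs] by blast
qed

lemma arcs_extended_double_cover:
  assumes "pair_graph G"
  shows
    "(Inl u, Inr v) \<in> parcs (extended_double_cover G) \<longleftrightarrow>
       u \<in> pverts G \<and> v \<in> pverts G \<and> (u = v \<or> (u, v) \<in> parcs G)"
    "(Inr u, Inl v) \<in> parcs (extended_double_cover G) \<longleftrightarrow>
       u \<in> pverts G \<and> v \<in> pverts G \<and> (u = v \<or> (u, v) \<in> parcs G)"
    "(Inl u, Inl v) \<notin> parcs (extended_double_cover G)"
    "(Inr u, Inr v) \<notin> parcs (extended_double_cover G)"
proof -
  interpret pair_graph G by fact
  have "(u, v) \<in> parcs G \<longleftrightarrow> (v, u) \<in> parcs G"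
    using arcs_symmetric by blast
  then show "(Inr u, Inl v) \<in> parcs (extended_double_cover G) \<longleftrightarrow>
       u \<in> pverts G \<and> v \<in> pverts G \<and> (u = v \<or> (u, v) \<in> parcs G)"
    by (auto simp: extended_double_cover_def)
qed (auto simp: extended_double_cover_def)

lemma adj_spectrum_extended_double_cover:
  assumes "pair_graph G"
  shows "adj_spectrum (extended_double_cover G) =
    image_mset (\<lambda>x. x + 1) (adj_spectrum G) + image_mset (\<lambda>x. - (x + 1)) (adj_spectrum G)"
proof -
  interpret pair_graph G by fact
  obtain vs where vs: "distinct vs" "set vs = pverts G"
    using finite_distinct_list[OF pair_finite_verts] by blast
  define n where "n = length vs"
  define A where "A = adjacency_matrix G vs"
  have A: "A \<in> carrier_mat n n"
    by (simp add: A_def n_def)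
  (* The unit coefficients put A + I into the form of mat_spectrum_affine. *)
  define B where "B = 1 \<cdot>\<^sub>m A + 1 \<cdot>\<^sub>m 1\<^sub>m n"
  have B: "B \<in> carrier_mat n n"
    using A by (simp add: B_def)
  define ws where "ws = map Inl vs @ map Inr vs"
  have ws: "distinct ws" "set ws = pverts (extended_double_cover G)"
    using vs by (auto simp: ws_def extended_double_cover_def distinct_map)
  have no_loop: "(v, v) \<notin> parcs G" for v
    using pair_no_loops[of "(v, v)"] by auto
  have entry: "B $$ (i, j) =
      (if vs ! i = vs ! j \<or> (vs ! i, vs ! j) \<in> parcs G then 1 else 0)" if "i < n" "j < n" for i j
    using that vs no_loop
    by (auto simp: B_def A_def adjacency_matrix_def n_def nth_eq_iff_index_eq)
  have "adjacency_matrix (extended_double_cover G) ws =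
      four_block_mat (0\<^sub>m n n) B B (0\<^sub>m n n)"
  proof (rule eq_matI)
    fix i j assume ij: "i < dim_row (four_block_mat (0\<^sub>m n n) B B (0\<^sub>m n n))"
      "j < dim_col (four_block_mat (0\<^sub>m n n) B B (0\<^sub>m n n))"
    have mem: "vs ! l \<in> pverts G" if "l < n" for l
      using that vs nth_mem unfolding n_def by blast
    show "adjacency_matrix (extended_double_cover G) ws $$ (i, j) =
        four_block_mat (0\<^sub>m n n) B B (0\<^sub>m n n) $$ (i, j)"
      using ij B mem
      by (simp add: adjacency_matrix_def ws_def nth_append entry n_def
          arcs_extended_double_cover[OF assms])
  qed (use B in \<open>auto simp: adjacency_matrix_def ws_def n_def\<close>)
  then have "adj_spectrum (extended_double_cover G) =
      mat_spectrum B + image_mset uminus (mat_spectrum B)"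
    using ws by (simp add: adj_spectrum_eq mat_spectrum_off_diagonal[OF B])
  also have "mat_spectrum B = image_mset (\<lambda>x. x + 1) (adj_spectrum G)"
    using vs mat_spectrum_affine[OF A, of 1 1] by (simp add: B_def A_def adj_spectrum_eq)
  finally show ?thesis
    by (simp add: image_mset.compositionality o_def)
qed

lemma adj_spectrum_kronecker_K2:
  assumes "finite (pverts H)"
  shows "adj_spectrum (kronecker_product H K2) = adj_spectrum H + image_mset uminus (adj_spectrum H)"
proof -
  obtain vs where vs: "distinct vs" "set vs = pverts H"
    using finite_distinct_list[OF assms] by blast
  define n where "n = length vs"
  define B where "B = adjacency_matrix H vs"
  have B: "B \<in> carrier_mat n n"
    by (simp add: B_def n_def)
  define ws where "ws = map (\<lambda>v. (v, False)) vs @ map (\<lambda>v. (v, True)) vs"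
  have ws: "distinct ws" "set ws = pverts (kronecker_product H K2)"
    using vs by (auto simp: ws_def kronecker_product_def K2_def distinct_map inj_on_def)
  have "adjacency_matrix (kronecker_product H K2) ws = four_block_mat (0\<^sub>m n n) B B (0\<^sub>m n n)"
    by (rule eq_matI)
      (auto simp: adjacency_matrix_def ws_def nth_append B_def kronecker_product_def K2_def n_def)
  then show ?thesis
    using ws vs mat_spectrum_off_diagonal[OF B] by (simp add: adj_spectrum_eq B_def)
qed

lemma adj_spectrum_edc_kronecker_K2:
  assumes "pair_graph G"
  shows "adj_spectrum (kronecker_product (extended_double_cover G) K2) =
    image_mset (\<lambda>x. x + 1) (adj_spectrum G) + image_mset (\<lambda>x. - (x + 1)) (adj_spectrum G) +
    image_mset (\<lambda>x. x + 1) (adj_spectrum G) + image_mset (\<lambda>x. - (x + 1)) (adj_spectrum G)"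
proof -
  interpret H: pair_graph "extended_double_cover G"
    by (rule pair_graph_extended_double_cover) fact
  show ?thesis
    by (simp add: adj_spectrum_kronecker_K2 H.pair_finite_verts
        adj_spectrum_extended_double_cover[OF assms] image_mset.compositionality o_def
        algebra_simps)
qed

lemma adj_spectrum_edc_edc:
  assumes "pair_graph G"
  shows "adj_spectrum (extended_double_cover (extended_double_cover G)) =
    image_mset (\<lambda>x. x + 2) (adj_spectrum G) + image_mset (\<lambda>x. - (x + 2)) (adj_spectrum G) +
    image_mset (\<lambda>x. x) (adj_spectrum G) + image_mset (\<lambda>x. - x) (adj_spectrum G)"
  by (simp add: adj_spectrum_extended_double_cover pair_graph_extended_double_cover assms
      image_mset.compositionality o_def algebra_simps)

section \<open>Comparing the two graphs\<close>

text \<open>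
  On the real line \<open>x + 1\<close> is the midpoint of \<open>x\<close> and \<open>x + 2\<close>, and the absolute value is affine on
  the segment between them unless \<open>0\<close> lies in its interior, that is, unless \<open>- 2 < x < 0\<close>.
\<close>

lemma energy_identity:
  fixes x :: complex
  assumes "x \<in> \<real>" and "x \<noteq> 0 \<longrightarrow> cmod x \<ge> 2"
  shows "2 * (cmod (x + 1) + cmod (- (x + 1))) =
    cmod (x + 2) + cmod (- (x + 2)) + cmod x + cmod (- x)"
proof -
  obtain r where r: "x = of_real r"
    using assms(1) by (auto elim: Reals_cases)
  have "cmod (x + 1) = \<bar>r + 1\<bar>" "cmod (x + 2) = \<bar>r + 2\<bar>" "cmod x = \<bar>r\<bar>"
    using norm_of_real[of "r + 1", where 'a = complex] norm_of_real[of "r + 2", where 'a = complex]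
    by (simp_all add: r)
  moreover have "r = 0 \<or> r \<ge> 2 \<or> r \<le> - 2"
    using assms(2) r by auto
  ultimately show ?thesis
    unfolding norm_minus_cancel by auto
qed

lemma second_moments_differ:
  fixes S :: "complex multiset"
  shows "(\<Sum>x\<in>#S. (x + 2)\<^sup>2 + (- (x + 2))\<^sup>2 + x\<^sup>2 + (- x)\<^sup>2) =
    (\<Sum>x\<in>#S. 2 * ((x + 1)\<^sup>2 + (- (x + 1))\<^sup>2)) + 4 * of_nat (size S)"
  by (induction S) (simp_all add: power2_eq_square algebra_simps)

theorem theorem2p8:
  fixes G :: "'a pair_pre_digraph"
  assumes "pair_graph G" and "pverts G \<noteq> {}"
  shows "((\<forall>x \<in># adj_spectrum G. x \<noteq> 0 \<longrightarrow> cmod x \<ge> 2) \<longrightarrow>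
            graph_energy (kronecker_product (extended_double_cover G) K2) =
            graph_energy (extended_double_cover (extended_double_cover G)))
       \<and> \<not> cospectral (kronecker_product (extended_double_cover G) K2)
                      (extended_double_cover (extended_double_cover G))
       \<and> card (pverts (kronecker_product (extended_double_cover G) K2)) =
           card (pverts (extended_double_cover (extended_double_cover G)))"
proof -
  interpret pair_graph G by fact
  let ?S = "adj_spectrum G"
  let ?K = "kronecker_product (extended_double_cover G) K2"
  let ?D = "extended_double_cover (extended_double_cover G)"
  have sum_K: "(\<Sum>x\<in>#adj_spectrum ?K. f x) = (\<Sum>x\<in>#?S. 2 * (f (x + 1) + f (- (x + 1))))"
    for f :: "complex \<Rightarrow> 'c :: comm_semiring_1"
    unfolding adj_spectrum_edc_kronecker_K2[OF assms(1)]
    by (simp add: image_mset.compositionality o_def sum_mset.distrib mult_2 ac_simps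
        del: minus_add_distrib)
  have sum_D: "(\<Sum>x\<in>#adj_spectrum ?D. f x) =
      (\<Sum>x\<in>#?S. f (x + 2) + f (- (x + 2)) + f x + f (- x))"
    for f :: "complex \<Rightarrow> 'c :: comm_semiring_1"
    unfolding adj_spectrum_edc_edc[OF assms(1)]
    by (simp add: image_mset.compositionality o_def sum_mset.distrib)
  have "graph_energy ?K = graph_energy ?D" if "\<forall>x \<in># ?S. x \<noteq> 0 \<longrightarrow> cmod x \<ge> 2"
    unfolding graph_energy_def sum_K sum_D
    using that adj_spectrum_real[OF assms(1)] energy_identity
    by (intro arg_cong[of _ _ sum_mset] image_mset_cong) blast
  moreover have "\<not> cospectral ?K ?D"
  proof
    assume "cospectral ?K ?D"
    then have "(\<Sum>x\<in>#adj_spectrum ?K. x\<^sup>2) = (\<Sum>x\<in>#adj_spectrum ?D. x\<^sup>2)"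
      by (simp add: cospectral_def)
    then have "size ?S = 0"
      unfolding sum_K sum_D second_moments_differ by simp
    then show False
      using assms(2) by (simp add: size_adj_spectrum pair_finite_verts)
  qed
  moreover have "card (pverts ?K) = card (pverts ?D)"
    by (simp add: kronecker_product_def K2_def extended_double_cover_def card_Plus
        card_cartesian_product pair_finite_verts)
  ultimately show ?thesis
    by blast
qed

end
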